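(* Let $l$, $n$ and $d\ge n$ be natural numbers and put $$\Psi(n,d,l)=2^{27}\, l\,(nd)^{3\log_3(nd)+9\log_3\log_3(nd)+36}.$$ Then every word over a linearly ordered $l$-letter alphabet of length at least $\Psi(n,d,l)$ either contains a subword of the form $x^d$ for some nonempty word $x$, or is $n$-divisible.
   Context: Lexicographic order on words: $u\succ v$ if there are (possibly empty) words $w,u',v'$ and letters $a\succ b$ with $u=wau'$, $v=wbv'$ (a word and its prefix are incomparable). A word $W$ is $n$-divisible if $W=v\,u_1u_2\cdots u_n$ with $u_1\succ u_2\succ\cdots\succ u_n$. A subword means a factor (a contiguous block of letters). Logarithms are to base $3$. *)

theory Defs
  imports Complex_Main "HOL-Library.Sublist"
begin

text \<open>
  Unlike in the library orders \<^const>\<open>lexord\<close> and \<^const>\<open>lexordp\<close>, a word and its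
  prefix are incomparable here.
\<close>

definition word_greater :: "'a::linorder list \<Rightarrow> 'a list \<Rightarrow> bool"  (infix "\<succ>" 50) where
  "u \<succ> v \<longleftrightarrow> (\<exists>w u' v' a b. u = w @ [a] @ u' \<and> v = w @ [b] @ v' \<and> a > b)"

definition n_divisible :: "nat \<Rightarrow> 'a::linorder list \<Rightarrow> bool" where
  "n_divisible n W \<longleftrightarrow> (\<exists>v us. length us = n \<and> W = v @ concat us \<and> successively (\<succ>) us)"

definition word_power :: "'a list \<Rightarrow> nat \<Rightarrow> 'a list" where
  "word_power x d = concat (replicate d x)"

text \<open>
  For \<open>n = d = 1\<close> the iterated logarithm is the junk value \<^term>\<open>log 3 0 :: real\<close>, which
  is harmless because the base of the power is then \<open>1\<close>.
\<close>

definition Psi :: "nat \<Rightarrow> nat \<Rightarrow> nat \<Rightarrow> real" where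
  "Psi n d l = 2 ^ 27 * real l *
     real (n * d) powr (3 * log 3 (real (n * d)) + 9 * log 3 (log 3 (real (n * d))) + 36)"

end

theory Submission
  imports Defs "HOL-Library.List_Lexorder"
begin

text \<open>
  Consider a word that has no \<open>n\<close>-division and is cut into blocks of equal length \<open>q\<close>. The sequence
  of blocks has no lexicographically decreasing subsequence of length \<open>n\<close>, so it splits into fewer
  than \<open>n\<close> weakly increasing sequences. If there are \<open>V\<close> different blocks, new values appear in
  these sequences fewer than \<open>n V\<close> times in total, so a fraction \<open>1 / (n V)\<close> of the word is a run
  without new values, and such a run contains fewer than \<open>n\<close> different blocks. Glueing \<open>k\<close>
  consecutive blocks of this run gives at most \<open>n\<^sup>k\<close> different blocks of length \<open>k q\<close>, and the
  argument repeats. After \<open>log\<^sub>k (n d)\<close> rounds, starting from single letters, the blocks have length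
  at least \<open>n d\<close>. The first \<open>n\<close> suffixes of such a block are pairwise comparable unless it contains
  a \<open>d\<close>-th power, and then no block occurs \<open>n\<close> times: choosing the \<open>i\<close>-th largest suffix in the
  \<open>i\<close>-th occurrence would give an \<open>n\<close>-division. The theorem takes \<open>k = 3\<close>.
\<close>

subsection \<open>The lexicographic order\<close>

lemma word_greater_iff_less_not_prefix: "u \<succ> v \<longleftrightarrow> v < u \<and> \<not> prefix v u"
proof
  assume "u \<succ> v"
  then obtain w a b u' v' where "u = w @ a # u'" "v = w @ b # v'" "b < a"
    by (auto simp: word_greater_def)
  then show "v < u \<and> \<not> prefix v u"
    by (auto simp: list_less_def intro: lexord_append_left_rightI)
next
  assume "v < u \<and> \<not> prefix v u"
  then obtain w a b u' v' where "u = w @ a # u'" "v = w @ b # v'" "b < a"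
    by (auto simp: list_less_def lexord_def prefix_def)
  then show "u \<succ> v"
    unfolding word_greater_def by (metis append_Cons append_Nil)
qed

lemma word_greater_prefix_mono:
  assumes "u \<succ> v" "prefix u u'" "prefix v v'"
  shows "u' \<succ> v'"
proof -
  obtain s t where "u' = u @ s" "v' = v @ t"
    using assms(2,3) by (auto simp: prefix_def)
  with \<open>u \<succ> v\<close> show ?thesis
    unfolding word_greater_def by (metis append_assoc)
qed

lemma successively_word_greater_prefix_mono:
  assumes "successively (\<succ>) us" "list_all2 prefix us vs"
  shows "successively (\<succ>) vs"
  using assms(2,1)
proof (induction rule: list_all2_induct)
  case (Cons u us v vs)
  then show ?case
    by (cases us; cases vs) (auto intro: word_greater_prefix_mono)
qed simp

lemma totalp_on_word_greater_same_length: "totalp_on {w. length w = q} (\<succ>)"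
proof (rule totalp_onI)
  fix u v :: "'a list"
  assume "u \<in> {w. length w = q}" "v \<in> {w. length w = q}" "u \<noteq> v"
  then have "\<not> prefix u v" "\<not> prefix v u" by (auto simp: prefix_def)
  with \<open>u \<noteq> v\<close> show "u \<succ> v \<or> v \<succ> u"
    by (auto simp: word_greater_iff_less_not_prefix)
qed

lemma ex_decreasing_list_if_prefix_antichain:
  assumes "finite S" and antichain: "\<And>u v. u \<in> S \<Longrightarrow> v \<in> S \<Longrightarrow> prefix u v \<Longrightarrow> u = v"
  shows "\<exists>ws. set ws = S \<and> length ws = card S \<and> successively (\<succ>) ws"
proof (intro exI conjI)
  let ?ws = "rev (sorted_list_of_set S)"
  show "set ?ws = S" using \<open>finite S\<close> by simp
  have "successively (<) (sorted_list_of_set S)"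
    by (simp add: successively_if_sorted_wrt)
  then have "successively (\<lambda>u v. v \<succ> u) (sorted_list_of_set S)"
    by (rule successively_mono)
      (use \<open>finite S\<close> antichain in \<open>auto simp: word_greater_iff_less_not_prefix\<close>)
  then show "successively (\<succ>) ?ws" by simp
qed simp

subsection \<open>Divisible words\<close>

lemma ex_decomposition_if_list_emb_sublist:
  assumes "list_emb sublist ws bs"
  shows "\<exists>v us. concat bs = v @ concat us \<and> list_all2 prefix ws us"
  using assms
proof induction
  case (list_emb_Nil bs)
  have "concat bs = concat bs @ concat []" "list_all2 prefix [] []" by simp_all
  then show ?case by blast
next
  case (list_emb_Cons ws bs b)
  then obtain v us where "concat bs = v @ concat us" "list_all2 prefix ws us" by blast
  then have "concat (b # bs) = (b @ v) @ concat us" by simp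
  with \<open>list_all2 prefix ws us\<close> show ?case by blast
next
  case (list_emb_Cons2 w b ws bs)
  then obtain v us where us: "concat bs = v @ concat us" "list_all2 prefix ws us" by blast
  obtain p s where "b = p @ w @ s" using \<open>sublist w b\<close> by (auto simp: sublist_def)
  then have "concat (b # bs) = p @ concat ((w @ s @ v) # us)" using us by simp
  moreover have "list_all2 prefix (w # ws) ((w @ s @ v) # us)" using us by simp
  ultimately show ?case by blast
qed

lemma n_divisible_concat_if_list_emb_sublist:
  assumes "list_emb sublist ws bs" "successively (\<succ>) ws"
  shows "n_divisible (length ws) (concat bs)"
proof -
  obtain v us where "concat bs = v @ concat us" "list_all2 prefix ws us"
    using ex_decomposition_if_list_emb_sublist[OF assms(1)] by blast
  with assms(2) show ?thesis
    unfolding n_divisible_def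
    by (metis list_all2_lengthD successively_word_greater_prefix_mono)
qed

lemma n_divisible_sublist:
  assumes "n_divisible n U" "sublist U W"
  shows "n_divisible n W"
proof -
  obtain v us where us: "length us = n" "U = v @ concat us" "successively (\<succ>) us"
    using \<open>n_divisible n U\<close> by (auto simp: n_divisible_def)
  obtain p s where "W = p @ U @ s" using \<open>sublist U W\<close> by (auto simp: sublist_def)
  then have "W = concat ([p, v] @ us @ [s])" using us by simp
  moreover have "list_emb sublist us ([p, v] @ us @ [s])"
    by (intro list_emb_append2 list_emb_prefix list_emb_refl) simp
  ultimately show ?thesis
    using n_divisible_concat_if_list_emb_sublist us by metis
qed

lemma n_divisible_antimono:
  assumes "n_divisible n W" "m \<le> n"
  shows "n_divisible m W"
proof -
  obtain v us where us: "length us = n" "W = v @ concat us" "successively (\<succ>) us"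
    using \<open>n_divisible n W\<close> by (auto simp: n_divisible_def)
  define as bs where "as = take (n - m) us" and "bs = drop (n - m) us"
  have split: "us = as @ bs" by (simp add: as_def bs_def)
  have "length bs = m" using us \<open>m \<le> n\<close> by (simp add: bs_def)
  moreover have "W = (v @ concat as) @ concat bs" using us split by simp
  moreover have "successively (\<succ>) bs" using us split by (simp add: successively_append_iff)
  ultimately show ?thesis unfolding n_divisible_def by blast
qed

lemma n_divisible_1: "n_divisible 1 W"
proof -
  have "length [W] = 1" "W = [] @ concat [W]" "successively (\<succ>) [W]" by simp_all
  then show ?thesis unfolding n_divisible_def by blast
qed

lemma one_less_if_not_n_divisible: "\<not> n_divisible n W \<Longrightarrow> 1 < n"
  using n_divisible_antimono[OF n_divisible_1] by (meson not_le)

subsection \<open>Powers and repeated blocks\<close>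

definition contains_power :: "nat \<Rightarrow> 'a list \<Rightarrow> bool" where
  "contains_power d W \<longleftrightarrow> (\<exists>x. x \<noteq> [] \<and> sublist (word_power x d) W)"

lemma contains_power_sublist: "contains_power d U \<Longrightarrow> sublist U W \<Longrightarrow> contains_power d W"
  unfolding contains_power_def using sublist_order.order_trans by blast

lemma contains_power_0: "contains_power 0 W"
  by (auto simp: contains_power_def word_power_def)

lemma length_word_power: "length (word_power x d) = d * length x"
  by (simp add: word_power_def length_concat sum_list_replicate)

lemma prefix_word_power_if_overlap:
  assumes "prefix y (x @ y)" "d * length x \<le> length (x @ y)"
  shows "prefix (word_power x d) (x @ y)"
  using assms(2)
proof (induction d)
  case (Suc d)
  then have "prefix (word_power x d) (x @ y)" "length (word_power x d) \<le> length y"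
    by (simp_all add: length_word_power)
  then have "prefix (word_power x d) y" using assms(1) prefix_length_prefix by blast
  then show ?case by (simp add: word_power_def)
qed (simp add: word_power_def)

lemma contains_power_if_prefix_drop:
  assumes "i < j" "j * d \<le> length u" and pre: "prefix (drop j u) (drop i u)"
  shows "contains_power d u"
proof (cases "d = 0")
  case False
  define x where "x = take (j - i) (drop i u)"
  have split: "drop i u = x @ drop j u"
    using append_take_drop_id[of "j - i" "drop i u"] \<open>i < j\<close> by (simp add: x_def)
  have "j \<le> j * d" using False by simp
  then have "j \<le> length u" using assms(2) by (rule le_trans)
  then have "length x = j - i" using \<open>i < j\<close> by (simp add: x_def)
  have "i + d * (j - i) \<le> i * d + (j - i) * d"
    using False by simp
  also have "\<dots> = j * d"
    using \<open>i < j\<close> by (simp flip: add_mult_distrib)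
  finally have "d * (j - i) \<le> length (drop i u)"
    using assms(2) by simp
  then have "prefix (word_power x d) (drop i u)"
    unfolding split
    by (intro prefix_word_power_if_overlap) (use pre split \<open>length x = j - i\<close> in auto)
  then have "sublist (word_power x d) u"
    by (meson prefix_imp_sublist sublist_drop sublist_order.order_trans)
  moreover have "x \<noteq> []" using \<open>length x = j - i\<close> \<open>i < j\<close> by auto
  ultimately show ?thesis by (auto simp: contains_power_def)
qed (simp add: contains_power_0)

lemma ex_decreasing_suffixes_if_no_power:
  assumes "\<not> contains_power d u" "n * d \<le> length u"
  shows "\<exists>ws. length ws = n \<and> (\<forall>w \<in> set ws. suffix w u) \<and> successively (\<succ>) ws"
proof -
  define S where "S = (\<lambda>i. drop i u) ` {..<n}"
  have "d \<noteq> 0" using assms(1) contains_power_0 by metis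
  then have "n \<le> length u" using assms(2) by (auto intro: le_trans[of n "n * d"])
  then have "inj_on (\<lambda>i. drop i u) {..<n}"
    by (auto intro!: inj_onI dest: arg_cong[where f = length])
  then have "card S = n" by (simp add: S_def card_image)
  have "drop i u = drop j u" if "i < n" "j < n" "prefix (drop i u) (drop j u)" for i j
  proof (cases i j rule: linorder_cases)
    case less
    then have "length (drop j u) < length (drop i u)"
      using that \<open>n \<le> length u\<close> by simp
    then show ?thesis using prefix_length_le[OF that(3)] by simp
  next
    case greater
    have "i * d \<le> length u" using that assms(2) by (meson less_imp_le mult_le_mono1 le_trans)
    then show ?thesis
      using contains_power_if_prefix_drop[OF greater _ that(3)] assms(1) by blast
  qed simp
  then obtain ws where "set ws = S" "length ws = card S" "successively (\<succ>) ws"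
    using ex_decreasing_list_if_prefix_antichain[of S] by (auto simp: S_def)
  moreover from this have "\<forall>w \<in> set ws. suffix w u" by (auto simp: S_def suffix_drop)
  ultimately show ?thesis using \<open>card S = n\<close> by metis
qed

lemma list_emb_if_length_le_count_list:
  assumes "length ws \<le> count_list bs u" "\<And>w. w \<in> set ws \<Longrightarrow> P w u"
  shows "list_emb P ws bs"
  using assms
proof (induction bs arbitrary: ws)
  case (Cons b bs)
  show ?case
  proof (cases ws)
    case (Cons w ws')
    then show ?thesis
      using Cons.IH[of ws] Cons.IH[of ws'] Cons.prems by (cases "b = u") auto
  qed simp
qed simp

lemma count_list_less_if_avoiding:
  assumes no_power: "\<not> contains_power d (concat bs)" and not_div: "\<not> n_divisible n (concat bs)"
    and "n * d \<le> length u"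
  shows "count_list bs u < n"
proof (rule ccontr)
  assume "\<not> count_list bs u < n"
  then have "count_list bs u \<noteq> 0" using one_less_if_not_n_divisible[OF not_div] by linarith
  then have "u \<in> set bs" by (simp add: count_list_0_iff)
  then have "sublist u (concat bs)"
    by (metis concat.simps(2) concat_append in_set_conv_decomp sublist_appendI)
  then have "\<not> contains_power d u" using no_power contains_power_sublist by blast
  then obtain ws where ws: "length ws = n" "\<And>w. w \<in> set ws \<Longrightarrow> suffix w u" "successively (\<succ>) ws"
    using ex_decreasing_suffixes_if_no_power \<open>n * d \<le> length u\<close> by metis
  have "list_emb sublist ws bs"
    by (rule list_emb_if_length_le_count_list[where u = u])
      (use ws \<open>\<not> count_list bs u < n\<close> in auto)
  then show False using n_divisible_concat_if_list_emb_sublist ws not_div by blast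
qed

subsection \<open>Runs with few values\<close>

text \<open>
  Here \<open>R\<close> need not be transitive, and only consecutive elements of a chain are compared. As in
  the proof of Mirsky's theorem, positions of equal rank are not related by \<open>R\<close> from left to
  right, so for the lexicographic order each rank carries a weakly increasing sequence.
\<close>

definition chain_rank :: "('a \<Rightarrow> 'a \<Rightarrow> bool) \<Rightarrow> 'a list \<Rightarrow> nat \<Rightarrow> nat" where
  "chain_rank R xs i = Max {length ys | ys. subseq ys (take i xs) \<and> successively R (ys @ [xs ! i])}"

lemma finite_chain_lengths: "finite {length ys | ys. subseq ys xs \<and> P ys}"
  by (rule finite_subset[of _ "{..length xs}"]) (auto dest: list_emb_length)

lemma ex_chain_of_rank:
  "\<exists>ys. subseq ys (take i xs) \<and> successively R (ys @ [xs ! i]) \<and> length ys = chain_rank R xs i"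
proof -
  let ?lengths = "{length ys | ys. subseq ys (take i xs) \<and> successively R (ys @ [xs ! i])}"
  have "length [] \<in> ?lengths" by fastforce
  then have "chain_rank R xs i \<in> ?lengths"
    unfolding chain_rank_def by (intro Max_in finite_chain_lengths) blast
  then show ?thesis by force
qed

lemma length_le_chain_rank:
  assumes "subseq ys (take i xs)" "successively R (ys @ [xs ! i])"
  shows "length ys \<le> chain_rank R xs i"
  unfolding chain_rank_def using assms by (intro Max_ge finite_chain_lengths) blast

lemma subseq_snoc_nth_take:
  assumes "subseq ys (take i xs)" "i < j" "j \<le> length xs"
  shows "subseq (ys @ [xs ! i]) (take j xs)"
proof -
  have "subseq (ys @ [xs ! i]) (take (Suc i) xs)"
    using assms by (simp add: take_Suc_conv_app_nth)
  moreover have "prefix (take (Suc i) xs) (take j xs)"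
    using \<open>i < j\<close> by (metis Suc_leI min.absorb1 take_is_prefix take_take)
  ultimately show ?thesis by (meson prefix_imp_subseq subseq_order.order_trans)
qed

lemma chain_rank_less:
  assumes "i < j" "j < length xs" "R (xs ! i) (xs ! j)"
  shows "chain_rank R xs i < chain_rank R xs j"
proof -
  obtain ys where ys: "subseq ys (take i xs)" "successively R (ys @ [xs ! i])"
      "length ys = chain_rank R xs i"
    using ex_chain_of_rank by metis
  have "successively R ((ys @ [xs ! i]) @ [xs ! j])"
    using ys(2) assms(3) by (subst successively_append_iff) simp
  then have "length (ys @ [xs ! i]) \<le> chain_rank R xs j"
    using subseq_snoc_nth_take[OF ys(1) assms(1)] assms(2) by (intro length_le_chain_rank) auto
  then show ?thesis using ys(3) by simp
qed

lemma chain_rank_less_if_no_chain: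
  assumes no_chain: "\<And>ys. subseq ys xs \<Longrightarrow> successively R ys \<Longrightarrow> length ys < n" and "i < length xs"
  shows "chain_rank R xs i < n - 1"
proof -
  obtain ys where ys: "subseq ys (take i xs)" "successively R (ys @ [xs ! i])"
      "length ys = chain_rank R xs i"
    using ex_chain_of_rank by metis
  have "subseq (ys @ [xs ! i]) xs"
    using subseq_snoc_nth_take[OF ys(1) \<open>i < length xs\<close>] by simp
  then have "length (ys @ [xs ! i]) < n" using no_chain ys(2) by blast
  then show ?thesis using ys(3) by simp
qed

definition ranked_nth :: "('a \<Rightarrow> 'a \<Rightarrow> bool) \<Rightarrow> 'a list \<Rightarrow> nat \<Rightarrow> nat \<times> 'a" where
  "ranked_nth R xs i = (chain_rank R xs i, xs ! i)"

lemma nth_eq_if_chain_rank_eq: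
  assumes total: "totalp_on (set xs) R" and "i \<le> j" "j < length xs"
    and seen: "ranked_nth R xs j \<in> ranked_nth R xs ` {..<i}"
    and rank: "chain_rank R xs i = chain_rank R xs j"
  shows "xs ! i = xs ! j"
proof (rule ccontr)
  assume "xs ! i \<noteq> xs ! j"
  with \<open>i \<le> j\<close> have "i < j" using le_neq_implies_less by blast
  then have "\<not> R (xs ! i) (xs ! j)" using chain_rank_less assms(3) rank by (metis less_irrefl)
  with \<open>xs ! i \<noteq> xs ! j\<close> \<open>i < j\<close> \<open>j < length xs\<close> have "R (xs ! j) (xs ! i)"
    using totalp_onD[OF total, of "xs ! i" "xs ! j"] by simp
  moreover obtain h where "h < i" "chain_rank R xs h = chain_rank R xs j" "xs ! h = xs ! j"
    using seen by (auto simp: ranked_nth_def)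
  ultimately show False
    using chain_rank_less[of h i xs R] \<open>i < j\<close> \<open>j < length xs\<close> rank by simp
qed

lemma ex_stationary_step:
  fixes F :: "nat \<Rightarrow> 'a set"
  assumes "mono F" "finite (F m)" "card (F m) < m"
  shows "\<exists>t < m. F (Suc t) = F t"
proof (rule ccontr)
  assume "\<not> ?thesis"
  then have strict: "F t \<subset> F (Suc t)" if "t < m" for t
    using that monoD[OF \<open>mono F\<close>, of t "Suc t"] by auto
  have "t \<le> card (F t)" if "t \<le> m" for t
    using that
  proof (induction t)
    case (Suc t)
    have "finite (F (Suc t))"
      using Suc.prems assms(1,2) by (meson monoD finite_subset)
    then have "card (F t) < card (F (Suc t))"
      using strict Suc.prems by (simp add: psubset_card_mono)
    then show ?case using Suc by simp
  qed simp
  from this[of m] show False using assms(3) by simp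
qed

lemma card_snd_image_le_if_inj_on_fst:
  assumes "fst ` P \<subseteq> A" "finite A" and inj: "inj_on fst P"
  shows "card (snd ` P) \<le> card A"
proof -
  have "finite P" using assms by (meson finite_imageD finite_subset)
  then have "card (snd ` P) \<le> card P" by (rule card_image_le)
  also have "\<dots> \<le> card A" using assms by (metis card_image card_mono)
  finally show ?thesis .
qed

lemma card_nth_image_less_if_all_ranked_seen:
  assumes total: "totalp_on (set xs) R"
    and no_chain: "\<And>ys. subseq ys xs \<Longrightarrow> successively R ys \<Longrightarrow> length ys < n"
    and "b \<le> length xs" and seen: "ranked_nth R xs ` {a..<b} \<subseteq> ranked_nth R xs ` {..<a}"
  shows "card ((!) xs ` {a..<b}) < n"
proof -
  let ?P = "ranked_nth R xs ` {a..<b}"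
  have same_value: "xs ! i = xs ! j"
    if "i \<in> {a..<b}" "j \<in> {a..<b}" "i \<le> j" "chain_rank R xs i = chain_rank R xs j" for i j
  proof (rule nth_eq_if_chain_rank_eq[OF total that(3) _ _ that(4)])
    show "j < length xs" using that(2) assms(3) by simp
    have "ranked_nth R xs ` {..<a} \<subseteq> ranked_nth R xs ` {..<i}" using that(1) by auto
    then show "ranked_nth R xs j \<in> ranked_nth R xs ` {..<i}" using seen that(2) by blast
  qed
  have "inj_on fst ?P"
  proof (rule inj_onI)
    fix p q
    assume "p \<in> ?P" "q \<in> ?P" "fst p = fst q"
    from \<open>p \<in> ?P\<close> obtain i where i: "p = ranked_nth R xs i" "i \<in> {a..<b}" by (rule imageE)
    from \<open>q \<in> ?P\<close> obtain j where j: "q = ranked_nth R xs j" "j \<in> {a..<b}" by (rule imageE)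
    have rank: "chain_rank R xs i = chain_rank R xs j"
      using \<open>fst p = fst q\<close> i(1) j(1) by (simp add: ranked_nth_def)
    then have "xs ! i = xs ! j" using same_value[of i j] same_value[of j i] i(2) j(2) by (metis nle_le)
    then show "p = q" using rank i(1) j(1) by (simp add: ranked_nth_def)
  qed
  moreover have "fst ` ?P \<subseteq> {..<n - 1}"
    using chain_rank_less_if_no_chain[OF no_chain] assms(3) by (auto simp: ranked_nth_def)
  ultimately have "card (snd ` ?P) \<le> n - 1"
    using card_snd_image_le_if_inj_on_fst[of ?P "{..<n - 1}"] by simp
  moreover have "snd ` ?P = (!) xs ` {a..<b}" by (simp add: image_image ranked_nth_def)
  moreover have "0 < n" using no_chain[of "[]"] by simp
  ultimately show ?thesis by simp
qed

lemma ex_sublist_with_few_values: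
  assumes total: "totalp_on (set xs) R"
    and no_chain: "\<And>ys. subseq ys xs \<Longrightarrow> successively R ys \<Longrightarrow> length ys < n"
    and card: "(n - 1) * card (set xs) < m" and len: "m * s \<le> length xs"
  shows "\<exists>ys. sublist ys xs \<and> length ys = s \<and> card (set ys) < n"
proof -
  define F where "F t = ranked_nth R xs ` {..<t * s}" for t
  have "ranked_nth R xs i \<in> {..<n - 1} \<times> set xs" if "i < length xs" for i
    using chain_rank_less_if_no_chain[OF no_chain that] that by (simp add: ranked_nth_def)
  then have "F m \<subseteq> {..<n - 1} \<times> set xs"
    unfolding F_def using len by (intro image_subsetI) (meson lessThan_iff less_le_trans)
  then have "card (F m) \<le> card ({..<n - 1} \<times> set xs)" by (intro card_mono) auto
  then have "card (F m) < m" using card by (simp add: card_cartesian_product)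
  moreover have "mono F"
    unfolding F_def by (intro monoI image_mono) simp
  moreover have "finite (F m)" by (simp add: F_def)
  ultimately obtain t where "t < m" and "F (Suc t) = F t"
    using ex_stationary_step by blast
  define a b where "a = t * s" and "b = Suc t * s"
  have "b \<le> length xs" unfolding b_def using \<open>t < m\<close> len by (meson Suc_leI mult_le_mono1 le_trans)
  have "ranked_nth R xs ` {a..<b} \<subseteq> F (Suc t)" by (auto simp: F_def b_def)
  then have "card ((!) xs ` {a..<b}) < n"
    using \<open>F (Suc t) = F t\<close> \<open>b \<le> length xs\<close>
    by (intro card_nth_image_less_if_all_ranked_seen[OF total no_chain]) (auto simp: F_def a_def)
  moreover define ys where "ys = take s (drop a xs)"
  have "ys = map ((!) xs) [a..<b]"
    using \<open>b \<le> length xs\<close> by (intro nth_equalityI) (auto simp: ys_def a_def b_def)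
  then have "set ys = (!) xs ` {a..<b}" "length ys = s" by (simp_all add: a_def b_def)
  moreover have "sublist ys xs"
    unfolding ys_def by (meson sublist_drop sublist_order.order_trans sublist_take)
  ultimately show ?thesis by (intro exI[of _ ys]) simp
qed

lemma ex_run_with_few_blocks:
  assumes not_div: "\<not> n_divisible n (concat bs)" and blocks: "set bs \<subseteq> {b. length b = q}"
    and "card (set bs) \<le> V" "0 < V" "n * V * s \<le> length bs"
  shows "\<exists>cs. sublist cs bs \<and> length cs = s \<and> card (set cs) < n"
proof (rule ex_sublist_with_few_values)
  show "totalp_on (set bs) (\<succ>)"
    using totalp_on_word_greater_same_length blocks by (rule totalp_on_subset)
  show "length ys < n" if "subseq ys bs" "successively (\<succ>) ys" for ys
  proof (rule ccontr)
    assume "\<not> length ys < n"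
    have "list_emb sublist ys bs" using that(1) by (rule list_emb_mono[rule_format, rotated]) auto
    then show False
      using n_divisible_concat_if_list_emb_sublist n_divisible_antimono that(2) not_div
        \<open>\<not> length ys < n\<close> by (meson not_less)
  qed
  have "(n - 1) * card (set bs) \<le> (n - 1) * V" using assms(3) by simp
  also have "\<dots> < n * V" using one_less_if_not_n_divisible[OF not_div] \<open>0 < V\<close> by simp
  finally show "(n - 1) * card (set bs) < n * V" .
qed (fact assms(5))

subsection \<open>Glueing blocks\<close>

definition glue_blocks :: "nat \<Rightarrow> 'a list list \<Rightarrow> 'a list list" where
  "glue_blocks k bs = map (\<lambda>i. concat (take k (drop (i * k) bs))) [0..<length bs div k]"

lemma length_glue_blocks: "length (glue_blocks k bs) = length bs div k"
  by (simp add: glue_blocks_def)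

lemma prefix_concat_glue_blocks: "prefix (concat (glue_blocks k bs)) (concat bs)"
proof -
  have "concat (map (\<lambda>i. concat (take k (drop (i * k) bs))) [0..<m]) = concat (take (m * k) bs)" for m
    by (induction m) (simp_all add: take_add add.commute[of k])
  then show ?thesis
    unfolding glue_blocks_def by (metis append_take_drop_id concat_append prefixI)
qed

lemma set_glue_blocks: "set (glue_blocks k bs) \<subseteq> concat ` {cs. set cs \<subseteq> set bs \<and> length cs = k}"
proof -
  have "set (take k (drop (i * k) bs)) \<subseteq> set bs \<and> length (take k (drop (i * k) bs)) = k"
    if "i < length bs div k" for i
  proof
    show "set (take k (drop (i * k) bs)) \<subseteq> set bs"
      by (meson order_trans set_drop_subset set_take_subset)
    have "Suc i * k \<le> length bs div k * k" using that by (intro mult_le_mono1) simp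
    also have "\<dots> \<le> length bs" by simp
    finally show "length (take k (drop (i * k) bs)) = k" by simp
  qed
  then show ?thesis by (auto simp: glue_blocks_def)
qed

lemma card_glue_blocks: "card (set (glue_blocks k bs)) \<le> card (set bs) ^ k"
proof -
  let ?groups = "{cs. set cs \<subseteq> set bs \<and> length cs = k}"
  have "finite ?groups" by (simp add: finite_lists_length_eq)
  then have "card (set (glue_blocks k bs)) \<le> card ?groups"
    using set_glue_blocks by (rule surj_card_le)
  then show ?thesis by (simp add: card_lists_length_eq)
qed

lemma set_glue_blocks_same_length:
  assumes "set bs \<subseteq> {b. length b = q}"
  shows "set (glue_blocks k bs) \<subseteq> {b. length b = k * q}"
proof -
  have "length (concat cs) = length cs * q" if "set cs \<subseteq> set bs" for cs
    using that assms by (induction cs) auto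
  then show ?thesis using set_glue_blocks[of k bs] by fastforce
qed

lemma sublist_concat: "sublist ys xs \<Longrightarrow> sublist (concat ys) (concat xs)"
  unfolding sublist_def by (metis concat_append)

subsection \<open>The length of a word that is not divisible and contains no power\<close>

lemma length_less_if_long_blocks:
  assumes "\<not> contains_power d (concat bs)" "\<not> n_divisible n (concat bs)"
    and "set bs \<subseteq> {b. n * d \<le> length b}" "card (set bs) \<le> V" "0 < V"
  shows "length bs < n * V"
proof -
  have "count_list bs u \<le> n - 1" if "u \<in> set bs" for u
    using count_list_less_if_avoiding[OF assms(1,2), of u] that assms(3) by force
  then have "sum (count_list bs) (set bs) \<le> card (set bs) * (n - 1)"
    using sum_bounded_above[of "set bs" "count_list bs" "n - 1"] by simp
  then have "length bs \<le> card (set bs) * (n - 1)"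
    by (simp add: sum_count_set)
  also have "\<dots> \<le> V * (n - 1)" using assms(4) by simp
  also have "\<dots> < n * V"
    using one_less_if_not_n_divisible[OF assms(2)] \<open>0 < V\<close> by simp
  finally show ?thesis .
qed

lemma length_less_if_avoiding:
  assumes "\<not> contains_power d (concat bs)" "\<not> n_divisible n (concat bs)"
    and "set bs \<subseteq> {b. length b = q}" "card (set bs) \<le> V" "0 < V"
    and "0 < k" "n * d \<le> k ^ j * q"
  shows "length bs < n * V * (k * n ^ Suc k) ^ j"
  using assms(1-5,7)
proof (induction j arbitrary: bs q V)
  case 0
  then show ?case using length_less_if_long_blocks[of d bs n V] by auto
next
  case (Suc j)
  define s where "s = n * n ^ k * (k * n ^ Suc k) ^ j"
  show ?case
  proof (rule ccontr)
    assume "\<not> length bs < n * V * (k * n ^ Suc k) ^ Suc j"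
    then have "n * V * (k * s) \<le> length bs" by (simp add: s_def mult_ac)
    then obtain cs where cs: "sublist cs bs" "length cs = k * s" "card (set cs) < n"
      using ex_run_with_few_blocks Suc.prems(2-5) by blast
    let ?gs = "glue_blocks k cs"
    have "sublist (concat ?gs) (concat bs)"
      using prefix_concat_glue_blocks sublist_concat[OF cs(1)]
      by (meson prefix_imp_sublist sublist_order.order_trans)
    then have "\<not> contains_power d (concat ?gs)" "\<not> n_divisible n (concat ?gs)"
      using Suc.prems(1,2) contains_power_sublist n_divisible_sublist by blast+
    moreover have "set ?gs \<subseteq> {b. length b = k * q}"
      using set_mono_sublist[OF cs(1)] Suc.prems(3) by (intro set_glue_blocks_same_length) blast
    moreover have "card (set ?gs) \<le> n ^ k"
      using card_glue_blocks[of k cs] power_mono[of "card (set cs)" n k] cs(3) by linarith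
    moreover have "0 < n ^ k" using one_less_if_not_n_divisible[OF Suc.prems(2)] by simp
    moreover have "n * d \<le> k ^ j * (k * q)" using Suc.prems(6) by (simp add: mult_ac)
    ultimately have "length ?gs < s" unfolding s_def by (rule Suc.IH)
    then show False using cs(2) \<open>0 < k\<close> by (simp add: length_glue_blocks)
  qed
qed

lemma length_word_less_if_avoiding:
  assumes "\<not> contains_power d W" "\<not> n_divisible n W"
    and "card (set W) \<le> l" "0 < l" "0 < k" "n * d \<le> k ^ j"
  shows "length W < n * l * (k * n ^ Suc k) ^ j"
proof -
  define bs where "bs = map (\<lambda>a. [a]) W"
  have "concat bs = W" by (simp add: bs_def)
  moreover have "card (set bs) \<le> l"
    using card_image_le[of "set W" "\<lambda>a. [a]"] assms(3) by (simp add: bs_def)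
  moreover have "set bs \<subseteq> {b. length b = 1}" by (auto simp: bs_def)
  ultimately have "length bs < n * l * (k * n ^ Suc k) ^ j"
    using length_less_if_avoiding[of d bs n 1 l k j] assms by simp
  then show ?thesis by (simp add: bs_def)
qed

lemma length_bound_le_Psi:
  assumes "2 \<le> n" "n \<le> d" "3 ^ j < n * d"
  shows "real (n * l * (3 * n ^ 4) ^ Suc j) \<le> Psi n d l"
proof -
  define N where "N = n * d"
  define L where "L = log 3 (real N)"
  have "n\<^sup>2 \<le> N" using assms(2) by (simp add: N_def power2_eq_square)
  then have "4 \<le> N" using power_mono[OF \<open>2 \<le> n\<close>, of 2] by simp
  then have "1 \<le> L" by (simp add: L_def)
  have "real (3 ^ j) < real N" using assms(3) unfolding N_def of_nat_less_iff .
  then have "real j < L" unfolding L_def by (intro less_log_of_power) simp_all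
  have "n * (n ^ 4) ^ Suc j = n ^ (4 * j + 5)"
    by (simp add: algebra_simps flip: power_mult power_Suc)
  also have "\<dots> \<le> n ^ (2 * (2 * j + 3))" using assms(1) by (intro power_increasing) auto
  also have "\<dots> \<le> N ^ (2 * j + 3)" using \<open>n\<^sup>2 \<le> N\<close> by (simp only: power_mult power_mono)
  finally have "n * l * (3 * n ^ 4) ^ Suc j \<le> l * (3 * 3 ^ j) * N ^ (2 * j + 3)"
    by (simp add: power_mult_distrib)
  also have "\<dots> \<le> l * (3 * N) * N ^ (2 * j + 3)" using assms(3) by (simp add: N_def)
  also have "\<dots> = 3 * l * N ^ (2 * j + 4)" by (simp add: eval_nat_numeral algebra_simps)
  finally have "real (n * l * (3 * n ^ 4) ^ Suc j) \<le> real (3 * l * N ^ (2 * j + 4))"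
    unfolding of_nat_le_iff .
  also have "\<dots> = 3 * real l * real N powr (2 * real j + 4)"
    using \<open>4 \<le> N\<close> powr_realpow[of "real N" "2 * j + 4"] by simp
  also have "\<dots> \<le> 2 ^ 27 * real l * real N powr (3 * L + 9 * log 3 L + 36)"
  proof (intro mult_mono powr_mono)
    have "0 \<le> log 3 L" using \<open>1 \<le> L\<close> by simp
    then show "2 * real j + 4 \<le> 3 * L + 9 * log 3 L + 36" using \<open>real j < L\<close> \<open>1 \<le> L\<close> by linarith
  qed (use \<open>4 \<le> N\<close> in auto)
  finally show ?thesis by (simp add: Psi_def L_def N_def)
qed

theorem theorem1p7p3:
  fixes l n d :: nat and A :: "'a::linorder set" and W :: "'a list"
  assumes "l \<ge> 1" and "n \<ge> 1" and "d \<ge> n"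
    and "finite A" and "card A = l"
    and "set W \<subseteq> A"
    and "real (length W) \<ge> Psi n d l"
  shows "(\<exists>x. x \<noteq> [] \<and> sublist (word_power x d) W) \<or> n_divisible n W"
proof (rule ccontr)
  assume "\<not> ?thesis"
  then have avoiding: "\<not> contains_power d W" "\<not> n_divisible n W"
    by (auto simp: contains_power_def)
  have "2 \<le> n" using one_less_if_not_n_divisible[OF avoiding(2)] by simp
  then have "2 \<le> n * d" using \<open>d \<ge> n\<close> by (metis le_trans mult_le_mono2 nat_mult_1_right assms(2))
  then obtain j where j: "3 ^ j < n * d" "n * d \<le> 3 ^ Suc j"
    using ex_power_ivl2[of 3 "n * d"] by auto
  have "card (set W) \<le> l" using assms(4-6) by (metis card_mono)
  then have "length W < n * l * (3 * n ^ Suc 3) ^ Suc j"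
    using length_word_less_if_avoiding[OF avoiding _ _ _ j(2)] \<open>l \<ge> 1\<close> by simp
  then have "real (length W) < real (n * l * (3 * n ^ 4) ^ Suc j)"
    by (simp only: of_nat_less_iff) simp
  also have "\<dots> \<le> Psi n d l" using \<open>2 \<le> n\<close> \<open>d \<ge> n\<close> j(1) by (rule length_bound_le_Psi)
  finally show False using assms(7) by simp
qed

end
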